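(* Let $\lambda=(\lambda_n)$ be a frequency satisfying Landau's condition $(LC)$. Then for all $\delta>0$ there is a constant $C=C(\delta,\lambda)$ such that for all $D=\sum a_n e^{-\lambda_n s}\in\mathcal{D}_\infty^{ext}(\lambda)$ and all $N\in\mathbf{N}$, $$\sup_{[Re>0]}\left|\sum_{n=1}^{N} a_n e^{-\lambda_n s}\right|\le C e^{\delta\lambda_N}\|D\|_\infty.$$ In particular, $\lambda$ satisfies Bohr's theorem.
   Context: A frequency is a strictly increasing sequence $\lambda=(\lambda_n)_{n\in\mathbf{N}}$ of non-negative real numbers tending to $+\infty$ ($\mathbf{N}=\{1,2,\dots\}$). A $\lambda$-Dirichlet series is a formal sum $D=\sum_{n\ge 1} a_n e^{-\lambda_n s}$ with complex coefficients $a_n$ and complex variable $s$. $[Re>\sigma]=\{s\in\mathbf{C}: \mathrm{Re}\,s>\sigma\}$. If $D$ converges at some point, it converges on some half-plane $[Re>\sigma]$ to a holomorphic function. $\mathcal{D}_\infty^{ext}(\lambda)$ is the space of all $\lambda$-Dirichlet series $D$ which converge at some point of $\mathbf{C}$ and whose limit function has a (unique) holomorphic and bounded extension $f$ to $[Re>0]$; $\|D\|_\infty:=\sup_{[Re>0]}|f(s)|$. Landau's condition $(LC)$: for every $\delta>0$ there is $C>0$ such that for all $n\in\mathbf{N}$, $\lambda_{n+1}-\lambda_n\ge C e^{-e^{\delta\lambda_n}}$. $\lambda$ satisfies Bohr's theorem if every $D\in\mathcal{D}_\infty^{ext}(\lambda)$ converges uniformly on $[Re>\varepsilon]$ for all $\varepsilon>0$.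 *)

theory Defs
  imports "HOL-Analysis.Analysis"
begin

text \<open>
  Sequences are indexed from 0: \<open>lam n\<close> and \<open>a n\<close> stand for the mathematical
  \<open>\<lambda>\<^sub>n\<^sub>+\<^sub>1\<close> and \<open>a\<^sub>n\<^sub>+\<^sub>1\<close>. A formal Dirichlet series with frequency \<open>lam\<close> is
  represented by its coefficient sequence \<open>a\<close>.
\<close>

definition frequency :: "(nat \<Rightarrow> real) \<Rightarrow> bool" where
  "frequency lam \<longleftrightarrow>
     strict_mono lam \<and> (\<forall>n. 0 \<le> lam n) \<and> filterlim lam at_top sequentially"

definition landau_condition :: "(nat \<Rightarrow> real) \<Rightarrow> bool" where
  "landau_condition lam \<longleftrightarrow>
     (\<forall>\<delta>>0. \<exists>C>0. \<forall>n. lam (Suc n) - lam n \<ge> C * exp (- exp (\<delta> * lam n)))"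

definition right_half_plane :: "real \<Rightarrow> complex set" where
  "right_half_plane \<sigma> = {s. Re s > \<sigma>}"

definition dirichlet_term :: "(nat \<Rightarrow> real) \<Rightarrow> (nat \<Rightarrow> complex) \<Rightarrow> complex \<Rightarrow> nat \<Rightarrow> complex" where
  "dirichlet_term lam a s n = a n * exp (- (of_real (lam n) * s))"

definition dirichlet_converges_at :: "(nat \<Rightarrow> real) \<Rightarrow> (nat \<Rightarrow> complex) \<Rightarrow> complex \<Rightarrow> bool" where
  "dirichlet_converges_at lam a s \<longleftrightarrow> summable (dirichlet_term lam a s)"

text \<open>
  The limit function of the series lives on its open half-planes of convergence;
  \<open>f\<close> extends it if both agree wherever such a half-plane meets \<open>[Re > 0]\<close>.
  (Values of \<open>f\<close> outside \<open>[Re > 0]\<close> are irrelevant.)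
\<close>

definition bounded_extension ::
    "(nat \<Rightarrow> real) \<Rightarrow> (nat \<Rightarrow> complex) \<Rightarrow> (complex \<Rightarrow> complex) \<Rightarrow> bool" where
  "bounded_extension lam a f \<longleftrightarrow>
     f holomorphic_on right_half_plane 0 \<and>
     bounded (f ` right_half_plane 0) \<and>
     (\<forall>\<sigma>. (\<forall>s\<in>right_half_plane \<sigma>. dirichlet_converges_at lam a s) \<longrightarrow>
        (\<forall>s\<in>right_half_plane \<sigma> \<inter> right_half_plane 0. f s = suminf (dirichlet_term lam a s)))"

definition D_infty_ext :: "(nat \<Rightarrow> real) \<Rightarrow> (nat \<Rightarrow> complex) set" where
  "D_infty_ext lam =
     {a. (\<exists>s. dirichlet_converges_at lam a s) \<and> (\<exists>f. bounded_extension lam a f)}"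

text \<open>
  For a frequency \<open>lam\<close> and \<open>a \<in> D_infty_ext lam\<close>, the series converges on some half-plane,
  so by the identity theorem all bounded extensions coincide on \<open>[Re > 0]\<close> and the norm
  does not depend on the choice made here.
\<close>

definition extension_of :: "(nat \<Rightarrow> real) \<Rightarrow> (nat \<Rightarrow> complex) \<Rightarrow> complex \<Rightarrow> complex" where
  "extension_of lam a = (SOME f. bounded_extension lam a f)"

definition D_infty_norm :: "(nat \<Rightarrow> real) \<Rightarrow> (nat \<Rightarrow> complex) \<Rightarrow> real" where
  "D_infty_norm lam a = (SUP s\<in>right_half_plane 0. cmod (extension_of lam a s))"

definition satisfies_bohr :: "(nat \<Rightarrow> real) \<Rightarrow> bool" where
  "satisfies_bohr lam \<longleftrightarrow>
     (\<forall>a\<in>D_infty_ext lam. \<forall>\<epsilon>>0.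
        uniformly_convergent_on (right_half_plane \<epsilon>)
          (\<lambda>N s. \<Sum>n\<le>N. dirichlet_term lam a s n))"

text \<open>The suprema of reals used here are over nonempty sets that are bounded above.\<close>

lemma right_half_plane_nonempty: "right_half_plane \<sigma> \<noteq> {}"
proof -
  have "of_real (\<sigma> + 1) \<in> right_half_plane \<sigma>"
    by (simp add: right_half_plane_def)
  then show ?thesis by blast
qed

lemma bdd_above_partial_sum:
  assumes "frequency lam"
  shows "bdd_above ((\<lambda>s. cmod (\<Sum>n\<le>N. dirichlet_term lam a s n)) ` right_half_plane 0)"
proof (rule bdd_aboveI2)
  fix s assume "s \<in> right_half_plane 0"
  then have "0 < Re s" by (simp add: right_half_plane_def)
  then have "cmod (dirichlet_term lam a s n) \<le> cmod (a n)" for n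
    using assms by (simp add: dirichlet_term_def norm_mult frequency_def mult_left_le)
  then show "cmod (\<Sum>n\<le>N. dirichlet_term lam a s n) \<le> (\<Sum>n\<le>N. cmod (a n))"
    by (rule sum_norm_le)
qed

lemma bdd_above_extension_of:
  assumes "a \<in> D_infty_ext lam"
  shows "bdd_above ((\<lambda>s. cmod (extension_of lam a s)) ` right_half_plane 0)"
proof -
  have "bounded_extension lam a (extension_of lam a)"
    using assms unfolding D_infty_ext_def extension_of_def by (simp add: some_eq_ex)
  then show ?thesis
    unfolding bounded_extension_def bounded_iff by (auto simp: bdd_above_def)
qed

end

(*
  The partial sum S_N is a smoothed Perron integral of the extension f that reproduces it exactly:
  put L = (l + lam N) / 2 and h = (l - lam N) / 4 with lam N < l <= lam (N + 1), and integrate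
  f (s + w) exp (L w) (sinh (h w) / (h w))^2 / w over the line Re w = 1 / l.  The terms up to N are
  recovered by closing the contour to the left, where only the pole at w = 0 contributes; the
  remainder f - S_N is O (|w| exp (- l Re w)) and disappears on closing to the right.  This needs no
  absolute convergence.  The quadratic decay of the sinh factor keeps the L^1 norm of the kernel on the line of
  order log (4 l / (l - lam N)), which Landau's condition bounds by a multiple of
  exp (delta lam N).  Bohr's theorem follows by Abel summation with delta = epsilon / 2.
*)
theory Submission
  imports Defs "HOL-Complex_Analysis.Complex_Analysis"
begin

section \<open>Abel summation and differences of exponentials\<close>

text \<open>Abel summation against a telescoping majorant: the increments of \<open>u\<close>,
  weighted by the block bounds, cost at most \<open>v m - v n\<close> in total, and the boundary
  term costs at most \<open>v n\<close>. The bound \<open>\<beta>\<close> may grow with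
  \<open>k\<close>, because blocks of a series in \<open>D_infty_ext\<close> are only bounded by a
  multiple of \<open>exp (\<delta> * lam k)\<close>.\<close>

lemma norm_sum_mult_le_Abel:
  fixes b u :: "nat \<Rightarrow> 'a :: real_normed_field" and v \<beta> :: "nat \<Rightarrow> real"
  assumes "m \<le> n"
    and B: "\<And>k. m \<le> k \<Longrightarrow> norm (sum b {m..k}) \<le> \<beta> k"
    and step: "\<And>k. m \<le> k \<Longrightarrow> \<beta> k * norm (u k - u (Suc k)) \<le> v k - v (Suc k)"
    and last: "\<And>k. m \<le> k \<Longrightarrow> \<beta> k * norm (u k) \<le> v k"
  shows "norm (\<Sum>k=m..n. b k * u k) \<le> v m"
proof -
  \<comment> \<open>With the boundary term subtracted, passing from \<open>n\<close> to
    \<open>Suc n\<close> adds exactly \<open>sum b {m..n} * (u n - u (Suc n))\<close>, so the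
    induction telescopes.\<close>
  have le: "norm ((\<Sum>k=m..n. b k * u k) - sum b {m..n} * u n) \<le> v m - v n"
    using \<open>m \<le> n\<close>
  proof (induction n rule: dec_induct)
    case base
    then show ?case by simp
  next
    case (step n)
    have "(\<Sum>k=m..Suc n. b k * u k) - sum b {m..Suc n} * u (Suc n)
        = ((\<Sum>k=m..n. b k * u k) - sum b {m..n} * u n) + sum b {m..n} * (u n - u (Suc n))"
      using step.hyps by (simp add: algebra_simps)
    also have "norm \<dots> \<le> (v m - v n) + \<beta> n * norm (u n - u (Suc n))"
      using step B[of n] by (intro order_trans[OF norm_triangle_ineq] add_mono)
        (auto simp: norm_mult intro!: mult_right_mono)
    also have "\<dots> \<le> v m - v (Suc n)"
      using assms(3)[of n] step.hyps by simp
    finally show ?case .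
  qed
  have "norm (sum b {m..n} * u n) \<le> v n"
    using B[of n] last[of n] \<open>m \<le> n\<close> by (auto simp: norm_mult intro: order_trans[OF mult_right_mono])
  with le show ?thesis
    using norm_triangle_ineq[of "(\<Sum>k=m..n. b k * u k) - sum b {m..n} * u n" "sum b {m..n} * u n"]
    by simp
qed

text \<open>The difference is the integral of \<open>z * exp (- t * z)\<close> over
  \<open>{p..q}\<close>, whose integrand has modulus \<open>norm z * exp (- t * Re z)\<close>. The
  bound is again a difference in \<open>p\<close> and \<open>q\<close>, which is the form that Abel
  summation telescopes.\<close>

lemma norm_exp_diff_le:
  fixes z :: complex
  assumes "0 < Re z" and "p \<le> q"
  shows "norm (exp (- (of_real p * z)) - exp (- (of_real q * z)))
    \<le> norm z / Re z * (exp (- p * Re z) - exp (- q * Re z))"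
proof -
  have 1: "((\<lambda>t. - z * exp (- (of_real t * z))) has_integral
      exp (- (of_real q * z)) - exp (- (of_real p * z))) {p..q}"
  proof (rule fundamental_theorem_of_calculus[OF \<open>p \<le> q\<close>])
    fix t
    have "((\<lambda>w. exp (- (w * z))) has_field_derivative - z * exp (- (of_real t * z))) (at (of_real t))"
      by (auto intro!: derivative_eq_intros)
    then show "((\<lambda>t. exp (- (of_real t * z))) has_vector_derivative - z * exp (- (of_real t * z)))
        (at t within {p..q})"
      by (rule has_vector_derivative_real_field)
  qed
  have 2: "((\<lambda>t. norm z * exp (- t * Re z)) has_integral
      (- (norm z / Re z) * exp (- q * Re z) - - (norm z / Re z) * exp (- p * Re z))) {p..q}"
    using assms by (intro fundamental_theorem_of_calculus)
      (auto intro!: derivative_eq_intros simp flip: has_real_derivative_iff_has_vector_derivative)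
  have "norm (integral {p..q} (\<lambda>t. - z * exp (- (of_real t * z))))
      \<le> integral {p..q} (\<lambda>t. norm z * exp (- t * Re z))"
    using 1 2 by (intro integral_norm_bound_integral) (auto simp: norm_mult integrable_on_def)
  then show ?thesis
    unfolding integral_unique[OF 1] integral_unique[OF 2]
    by (simp add: norm_minus_commute algebra_simps)
qed

section \<open>The entire kernel and its growth\<close>

definition sinhc :: "complex \<Rightarrow> complex" where
  "sinhc w = (if w = 0 then 1 else sinh w / w)"

lemma sinhc_0 [simp]: "sinhc 0 = 1"
  by (simp add: sinhc_def)

lemma holomorphic_sinhc: "sinhc holomorphic_on UNIV"
proof -
  have "deriv sinh (0::complex) = 1"
    by (rule DERIV_imp_deriv) (auto intro!: derivative_eq_intros)
  moreover have "(sinh :: complex \<Rightarrow> complex) holomorphic_on UNIV"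
    unfolding sinh_field_def by (intro holomorphic_intros) auto
  ultimately show ?thesis
    using pole_lemma[of sinh UNIV 0] by (simp add: sinhc_def[abs_def] if_distrib cong: if_cong)
qed

text \<open>The source of decay for large \<open>w\<close>. Written as a product so that it also
  covers \<open>w = 0\<close>.\<close>

lemma norm_sinhc_mult_le: "norm (sinhc w) * norm w \<le> exp \<bar>Re w\<bar>"
proof -
  have "sinhc w * w = sinh w"
    by (simp add: sinhc_def)
  then have "norm (sinhc w) * norm w = norm (exp w - exp (-w)) / 2"
    by (simp only: flip: norm_mult) (simp only: sinh_field_def norm_divide norm_numeral)
  also have "\<dots> \<le> (norm (exp w) + norm (exp (-w))) / 2"
    by (intro divide_right_mono norm_triangle_ineq4) auto
  also have "\<dots> \<le> (exp \<bar>Re w\<bar> + exp \<bar>Re w\<bar>) / 2"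
    by (intro divide_right_mono add_mono) auto
  finally show ?thesis by simp
qed

text \<open>Mean value inequality from 0 to \<open>w\<close> in the convex strip \<bar>Re z\<bar>
  \<le> \<bar>Re w\<bar>, where the derivative \<open>cosh\<close> is at most
  \<open>exp \<bar>Re w\<bar>\<close>. This controls the kernel near 0, where the preceding bound is
  weak.\<close>

lemma norm_sinhc_le: "norm (sinhc w) \<le> exp \<bar>Re w\<bar>"
proof (cases "w = 0")
  case False
  have "norm (sinh w - sinh 0) \<le> exp \<bar>Re w\<bar> * norm (w - 0)"
  proof (rule field_differentiable_bound[where f' = cosh and S = "{z. \<bar>Re z\<bar> \<le> \<bar>Re w\<bar>}"])
    have "{z::complex. \<bar>Re z\<bar> \<le> \<bar>Re w\<bar>} = {z. Re z \<le> \<bar>Re w\<bar>} \<inter> {z. Re z \<ge> - \<bar>Re w\<bar>}"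
      by auto
    then show "convex {z::complex. \<bar>Re z\<bar> \<le> \<bar>Re w\<bar>}"
      by (simp add: convex_Int convex_halfspace_Re_le convex_halfspace_Re_ge)
    fix z :: complex assume "z \<in> {z. \<bar>Re z\<bar> \<le> \<bar>Re w\<bar>}"
    then have z: "\<bar>Re z\<bar> \<le> \<bar>Re w\<bar>" by simp
    show "(sinh has_field_derivative cosh z) (at z within {z. \<bar>Re z\<bar> \<le> \<bar>Re w\<bar>})"
      by (auto intro!: derivative_eq_intros)
    have "norm (cosh z) = norm (exp z + exp (-z)) / 2"
      by (simp add: cosh_field_def norm_divide)
    also have "\<dots> \<le> (norm (exp z) + norm (exp (-z))) / 2"
      by (intro divide_right_mono norm_triangle_ineq) auto
    also have "\<dots> \<le> (exp \<bar>Re w\<bar> + exp \<bar>Re w\<bar>) / 2"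
      using z by (intro divide_right_mono add_mono) auto
    finally show "norm (cosh z) \<le> exp \<bar>Re w\<bar>" by simp
  qed auto
  then show ?thesis
    using False by (simp add: sinhc_def norm_divide field_simps)
qed simp

text \<open>For \<open>h > 0\<close> this is the integral of \<open>exp (w * t)\<close> against the
  triangular probability density on the interval from \<open>L - 2 * h\<close> to
  \<open>L + 2 * h\<close>. Division by \<open>w\<close> turns the density into a cut-off that is 1
  to the left of the interval and 0 to its right; in the application the interval is
  \<open>{lam N..l}\<close>.\<close>

definition perron_kernel :: "real \<Rightarrow> real \<Rightarrow> complex \<Rightarrow> complex" where
  "perron_kernel L h w = exp (of_real L * w) * sinhc (of_real h * w) ^ 2"

lemma perron_kernel_0 [simp]: "perron_kernel L h 0 = 1"
  by (simp add: perron_kernel_def)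

lemma holomorphic_perron_kernel: "perron_kernel L h holomorphic_on S"
proof -
  have "(\<lambda>w. sinhc (of_real h * w)) holomorphic_on S"
    using holomorphic_on_compose_gen[OF _ holomorphic_sinhc, of "\<lambda>w. of_real h * w" S]
    by (auto simp: o_def intro!: holomorphic_intros)
  then show ?thesis
    unfolding perron_kernel_def[abs_def] by (intro holomorphic_intros)
qed

text \<open>The two bounds on \<open>sinhc\<close>, squared. The exponent is
  \<open>(L + 2 * h) * Re w\<close> in the right half-plane and \<open>(L - 2 * h) * Re w\<close> in
  the left one: the two ends of the support of the density.\<close>

lemma norm_perron_kernel_le:
  assumes "0 < h"
  shows "norm (perron_kernel L h w) \<le> exp (L * Re w + 2 * h * \<bar>Re w\<bar>)"
    and "norm (perron_kernel L h w) * (h * norm w)\<^sup>2 \<le> exp (L * Re w + 2 * h * \<bar>Re w\<bar>)"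
proof -
  have e: "exp (L * Re w + 2 * h * \<bar>Re w\<bar>) = exp (L * Re w) * exp (h * \<bar>Re w\<bar>) ^ 2"
    by (simp add: exp_add mult.assoc flip: exp_double)
  have abs: "\<bar>Re (of_real h * w)\<bar> = h * \<bar>Re w\<bar>"
    using assms by (simp add: abs_mult)
  have "norm (sinhc (of_real h * w)) ^ 2 \<le> exp (h * \<bar>Re w\<bar>) ^ 2"
    using norm_sinhc_le[of "of_real h * w"] unfolding abs by (intro power_mono) auto
  then show "norm (perron_kernel L h w) \<le> exp (L * Re w + 2 * h * \<bar>Re w\<bar>)"
    unfolding e by (simp add: perron_kernel_def norm_mult norm_power)
  have "(norm (sinhc (of_real h * w)) * norm (of_real h * w)) ^ 2 \<le> exp (h * \<bar>Re w\<bar>) ^ 2"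
    using norm_sinhc_mult_le[of "of_real h * w"] unfolding abs by (intro power_mono) auto
  then show "norm (perron_kernel L h w) * (h * norm w)\<^sup>2 \<le> exp (L * Re w + 2 * h * \<bar>Re w\<bar>)"
    unfolding e using assms by (simp add: perron_kernel_def norm_mult norm_power power_mult_distrib)
qed

section \<open>Closing a vertical segment to a rectangle\<close>

lemma contour_integral_rectpath:
  assumes "Re a1 \<le> Re a3" "Im a1 \<le> Im a3"
    and cont: "continuous_on (path_image (rectpath a1 a3)) g"
    and I: "(g has_contour_integral I) (rectpath a1 a3)"
  defines "a2 \<equiv> Complex (Re a3) (Im a1)" and "a4 \<equiv> Complex (Re a1) (Im a3)"
  shows "I = contour_integral (linepath a1 a2) g + contour_integral (linepath a2 a3) g
    + contour_integral (linepath a3 a4) g + contour_integral (linepath a4 a1) g"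
proof -
  have img: "path_image (rectpath a1 a3) = closed_segment a1 a2 \<union> closed_segment a2 a3
      \<union> closed_segment a3 a4 \<union> closed_segment a4 a1"
    by (simp add: rectpath_def Let_def a2_def a4_def path_image_join Un_assoc)
  have int: "(g has_contour_integral contour_integral (linepath p q) g) (linepath p q)"
    if "closed_segment p q \<subseteq> path_image (rectpath a1 a3)" for p q
    using continuous_on_subset[OF cont that]
    by (intro has_contour_integral_integral contour_integrable_continuous_linepath)
  have "(g has_contour_integral (contour_integral (linepath a1 a2) g + (contour_integral (linepath a2 a3) g
    + (contour_integral (linepath a3 a4) g + contour_integral (linepath a4 a1) g)))) (rectpath a1 a3)"
    unfolding rectpath_def Let_def a2_def[symmetric] a4_def[symmetric]
    by (intro has_contour_integral_join int valid_path_join valid_path_linepath)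
      (auto simp: img)
  then show ?thesis
    using I has_contour_integral_unique by (fastforce simp: add.assoc)
qed

text \<open>Cauchy's integral formula on the rectangle with corners \<open>Complex (-T) (-T)\<close>
  and \<open>Complex c T\<close>, which encloses 0. The three sides other than the given segment
  have distance \<open>T\<close> from 0 and total length at most \<open>6 * T\<close>.\<close>

lemma contour_integral_left_square:
  assumes holo: "P holomorphic_on UNIV" and "0 < c" "c < T" "0 \<le> B"
    and bound: "\<And>w. Re w \<le> c \<Longrightarrow> T \<le> norm w \<Longrightarrow> norm (P w / w) \<le> B"
  shows "norm (contour_integral (linepath (Complex c (-T)) (Complex c T)) (\<lambda>w. P w / w)
    - 2 * of_real pi * \<i> * P 0) \<le> B * (6 * T)"
proof -
  define a1 a2 a3 a4 where "a1 = Complex (-T) (-T)" and "a2 = Complex c (-T)"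
    and "a3 = Complex c T" and "a4 = Complex (-T) T"
  let ?g = "\<lambda>w. P w / w"
  have T: "0 < T" using assms by simp
  have box: "0 \<in> box a1 a3"
    using assms by (auto simp: in_box_complex_iff a1_def a3_def)
  have nz: "0 \<notin> path_image (rectpath a1 a3)"
    using box assms path_image_rectpath_inter_box[of a1 a3] by (auto simp: a1_def a3_def)
  have "((\<lambda>w. P w / (w - 0)) has_contour_integral
      of_real (2 * pi) * \<i> * winding_number (rectpath a1 a3) 0 * P 0) (rectpath a1 a3)"
    by (rule Cauchy_integral_formula_convex_simple[where S = UNIV]) (use nz holo in auto)
  moreover have "winding_number (rectpath a1 a3) 0 = 1"
    using box by (rule winding_number_rectpath)
  ultimately have I: "(?g has_contour_integral 2 * of_real pi * \<i> * P 0) (rectpath a1 a3)"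
    by simp
  have cont: "continuous_on X ?g" if "0 \<notin> X" for X
    using that holomorphic_on_subset[OF holo subset_UNIV]
    by (intro continuous_on_divide continuous_on_id holomorphic_on_imp_continuous_on) auto
  have "2 * of_real pi * \<i> * P 0 = contour_integral (linepath a1 a2) ?g
      + contour_integral (linepath a2 a3) ?g + contour_integral (linepath a3 a4) ?g
      + contour_integral (linepath a4 a1) ?g"
    using contour_integral_rectpath[OF _ _ cont[OF nz] I] assms
    by (simp add: a1_def a2_def a3_def a4_def)
  then have "contour_integral (linepath a2 a3) ?g - 2 * of_real pi * \<i> * P 0 =
      - (contour_integral (linepath a1 a2) ?g + contour_integral (linepath a3 a4) ?g
      + contour_integral (linepath a4 a1) ?g)"
    by (simp add: algebra_simps)
  then have "norm (contour_integral (linepath a2 a3) ?g - 2 * of_real pi * \<i> * P 0)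
      = norm (contour_integral (linepath a1 a2) ?g + contour_integral (linepath a3 a4) ?g
      + contour_integral (linepath a4 a1) ?g)"
    by (simp only: norm_minus_cancel)
  also have "\<dots> \<le> norm (contour_integral (linepath a1 a2) ?g)
      + norm (contour_integral (linepath a3 a4) ?g) + norm (contour_integral (linepath a4 a1) ?g)"
    by (intro order_trans[OF norm_triangle_ineq] add_mono) auto
  also have "\<dots> \<le> B * norm (a2 - a1) + B * norm (a4 - a3) + B * norm (a1 - a4)"
  proof -
    have side: "norm (contour_integral (linepath p q) ?g) \<le> B * norm (q - p)"
      if pq: "\<And>w. w \<in> closed_segment p q \<Longrightarrow> Re w \<le> c \<and> T \<le> norm w" for p q
    proof (rule contour_integral_bound_linepath)
      have "0 \<notin> closed_segment p q" using pq[of 0] T by force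
      from cont[OF this] show "?g contour_integrable_on linepath p q"
        by (rule contour_integrable_continuous_linepath)
      show "norm (P w / w) \<le> B" if "w \<in> closed_segment p q" for w
        using pq[OF that] by (intro bound) simp_all
    qed (rule \<open>0 \<le> B\<close>)
    have n: "T \<le> norm w" if "\<bar>Re w\<bar> = T \<or> \<bar>Im w\<bar> = T" for w
      using that abs_Re_le_cmod[of w] abs_Im_le_cmod[of w] by auto
    show ?thesis
      using \<open>0 < c\<close> \<open>c < T\<close> T
      by (intro add_mono side conjI n)
        (auto simp: a1_def a2_def a3_def a4_def closed_segment_same_Re closed_segment_same_Im
          closed_segment_eq_real_ivl)
  qed
  also have "\<dots> = B * ((T + c) + (T + c) + 2 * T)"
  proof -
    have "a2 - a1 = of_real (T + c)" "a4 - a3 = of_real (- (T + c))" "a1 - a4 = of_real (2 * T) * (- \<i>)"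
      by (simp_all add: a1_def a2_def a3_def a4_def complex_eq_iff)
    then have "norm (a2 - a1) = T + c" "norm (a4 - a3) = T + c" "norm (a1 - a4) = 2 * T"
      using \<open>0 < c\<close> T by (simp_all add: norm_mult del: of_real_mult of_real_add of_real_diff of_real_minus)
    then show ?thesis by (simp add: ring_distribs)
  qed
  also have "\<dots> \<le> B * (6 * T)"
    using assms by (intro mult_left_mono) auto
  finally show ?thesis by (simp add: a2_def a3_def)
qed

text \<open>Cauchy's theorem on the rectangle with corners \<open>Complex c (-T)\<close> and
  \<open>Complex T T\<close>, inside the half-plane of holomorphy. The three sides other than the
  given segment have total length at most \<open>4 * T\<close>.\<close>

lemma contour_integral_right_square:
  assumes holo: "Q holomorphic_on {w. 0 < Re w}" and "0 < c" "c < T" "0 \<le> B"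
    and bound: "\<And>w. 0 < Re w \<Longrightarrow> T \<le> norm w \<Longrightarrow> norm (Q w) \<le> B"
  shows "norm (contour_integral (linepath (Complex c (-T)) (Complex c T)) Q) \<le> B * (4 * T)"
proof -
  define a1 a2 a3 a4 where "a1 = Complex c (-T)" and "a2 = Complex T (-T)"
    and "a3 = Complex T T" and "a4 = Complex c T"
  have T: "0 < T" using assms by simp
  have sub: "path_image (rectpath a1 a3) \<subseteq> {w. 0 < Re w}"
    using assms by (auto simp: path_image_rectpath a1_def a3_def)
  have I: "(Q has_contour_integral 0) (rectpath a1 a3)"
    using sub by (intro Cauchy_theorem_convex_simple[OF holo] convex_halfspace_Re_gt) auto
  have cont: "continuous_on X Q" if "X \<subseteq> {w. 0 < Re w}" for X
    using holomorphic_on_imp_continuous_on[OF holo] that continuous_on_subset by blast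
  have "0 = contour_integral (linepath a1 a2) Q
      + contour_integral (linepath a2 a3) Q + contour_integral (linepath a3 a4) Q
      + contour_integral (linepath a4 a1) Q"
    using contour_integral_rectpath[OF _ _ cont[OF sub] I] assms
    by (simp add: a1_def a2_def a3_def a4_def)
  then have "- contour_integral (linepath a4 a1) Q = contour_integral (linepath a1 a2) Q
      + contour_integral (linepath a2 a3) Q + contour_integral (linepath a3 a4) Q"
    by (metis add.commute neg_eq_iff_add_eq_0)
  \<comment> \<open>The rectangle runs down its left side, from \<open>a4\<close> to
    \<open>a1\<close>, while the claim concerns the upward segment.\<close>
  moreover have "closed_segment a1 a4 \<subseteq> {w. 0 < Re w}"
    using assms T by (auto simp: a1_def a4_def closed_segment_same_Re)
  then have "contour_integral (linepath a1 a4) Q = - contour_integral (linepath a4 a1) Q"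
    by (intro contour_integral_reverse_linepath cont)
  ultimately have "norm (contour_integral (linepath a1 a4) Q) \<le> norm (contour_integral (linepath a1 a2) Q)
      + norm (contour_integral (linepath a2 a3) Q) + norm (contour_integral (linepath a3 a4) Q)"
    by (auto intro!: order_trans[OF norm_triangle_ineq] add_mono)
  also have "\<dots> \<le> B * norm (a2 - a1) + B * norm (a3 - a2) + B * norm (a4 - a3)"
  proof -
    have side: "norm (contour_integral (linepath p q) Q) \<le> B * norm (q - p)"
      if pq: "\<And>w. w \<in> closed_segment p q \<Longrightarrow> 0 < Re w \<and> T \<le> norm w" for p q
    proof (rule contour_integral_bound_linepath)
      show "Q contour_integrable_on linepath p q"
        using pq by (intro contour_integrable_continuous_linepath cont) auto
    qed (use pq bound \<open>0 \<le> B\<close> in blast)+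
    have n: "T \<le> norm w" if "\<bar>Re w\<bar> = T \<or> \<bar>Im w\<bar> = T" for w
      using that abs_Re_le_cmod[of w] abs_Im_le_cmod[of w] by auto
    show ?thesis
      using \<open>0 < c\<close> \<open>c < T\<close> T
      by (intro add_mono side conjI n)
        (auto simp: a1_def a2_def a3_def a4_def closed_segment_same_Re closed_segment_same_Im
          closed_segment_eq_real_ivl)
  qed
  also have "\<dots> = B * ((T - c) + 2 * T + (T - c))"
  proof -
    have "a2 - a1 = of_real (T - c)" "a3 - a2 = of_real (2 * T) * \<i>" "a4 - a3 = of_real (c - T)"
      by (simp_all add: a1_def a2_def a3_def a4_def complex_eq_iff)
    then have "norm (a2 - a1) = T - c" "norm (a3 - a2) = 2 * T" "norm (a4 - a3) = T - c"
      using \<open>c < T\<close> T by (simp_all add: norm_mult del: of_real_mult of_real_add of_real_diff of_real_minus)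
    then show ?thesis by (simp add: ring_distribs)
  qed
  also have "\<dots> \<le> B * (4 * T)"
    using assms by (intro mult_left_mono) auto
  finally show ?thesis by (simp add: a1_def a4_def)
qed

section \<open>The kernel on the line of integration\<close>

text \<open>Partial fractions give the antiderivative \<open>A\<close> for t \<ge> 0, and the
  integrand is even. The bound is uniform in \<open>T\<close> since (c + T) / (1 + h T) \<le> 1 / h.
  The hypothesis on \<open>h * c\<close> gives 1 / (1 - h c) \<le> 4/3; two halves make 8/3.\<close>

lemma integral_perron_majorant:
  fixes c h T :: real
  assumes "0 < c" "0 < h" "h * c \<le> 1/4" "0 < T"
  shows "(\<lambda>t. 1 / ((c + \<bar>t\<bar>) * (1 + h * \<bar>t\<bar>))) integrable_on {-T..T}"
    and "integral {-T..T} (\<lambda>t. 1 / ((c + \<bar>t\<bar>) * (1 + h * \<bar>t\<bar>))) \<le> 8/3 * ln (1 / (h * c))"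
proof -
  let ?j = "\<lambda>t. 1 / ((c + \<bar>t\<bar>) * (1 + h * \<bar>t\<bar>))"
  define A where "A = (\<lambda>t. (ln (c + t) - ln (1 + h * t)) / (1 - h * c))"
  have "((\<lambda>t. 1 / ((c + t) * (1 + h * t))) has_integral (A T - A 0)) {0..T}"
  proof (rule fundamental_theorem_of_calculus)
    fix t assume "t \<in> {0..T}"
    then have "0 < c + t" "0 < 1 + h * t"
      using assms by (auto intro: add_pos_nonneg)
    then have "(A has_real_derivative (1 / (c + t) - h / (1 + h * t)) / (1 - h * c)) (at t)"
      unfolding A_def using assms by (auto intro!: derivative_eq_intros)
    also have "1 / (c + t) - h / (1 + h * t) = (1 - h * c) / ((c + t) * (1 + h * t))"
      using \<open>0 < c + t\<close> \<open>0 < 1 + h * t\<close> by (simp add: field_simps)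
    also have "\<dots> / (1 - h * c) = 1 / ((c + t) * (1 + h * t))"
      using assms by simp
    finally have "(A has_real_derivative 1 / ((c + t) * (1 + h * t))) (at t)" .
    then show "(A has_vector_derivative 1 / ((c + t) * (1 + h * t))) (at t within {0..T})"
      by (simp add: has_real_derivative_iff_has_vector_derivative has_vector_derivative_at_within)
  qed (use assms in simp)
  then have 1: "(?j has_integral (A T - A 0)) {0..T}"
    by (rule has_integral_eq[rotated]) simp
  then have "((\<lambda>t. ?j (- t)) has_integral (A T - A 0)) {-T..-0}"
    by (subst has_integral_reflect_real)
  then have "(?j has_integral (A T - A 0)) {-T..0}"
    by simp
  then have I: "(?j has_integral (A T - A 0) + (A T - A 0)) {-T..T}"
    using 1 assms by (intro has_integral_combine[of "-T" 0 T]) auto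
  then show "?j integrable_on {-T..T}"
    by blast
  have "0 < c + T" "0 < 1 + h * T"
    using assms by (auto intro: add_pos_pos)
  then have "ln (c + T) - ln (1 + h * T) = ln ((c + T) / (1 + h * T))"
    by (simp add: ln_div)
  also have "\<dots> \<le> ln (1 / h)"
    using assms by (subst ln_le_cancel_iff) (auto simp: field_simps add_pos_pos)
  finally have "A T - A 0 \<le> (ln (1 / h) - ln c) / (1 - h * c)"
    using assms unfolding A_def diff_divide_distrib[symmetric] by (intro divide_right_mono) auto
  also have "ln (1 / h) - ln c = ln (1 / (h * c))"
    using assms by (simp add: ln_div ln_mult)
  also have "ln (1 / (h * c)) / (1 - h * c) \<le> ln (1 / (h * c)) / (3/4)"
    using assms by (intro divide_left_mono) (auto intro!: mult_pos_pos)
  finally have "A T - A 0 \<le> 4/3 * ln (1 / (h * c))"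
    by simp
  then show "integral {-T..T} ?j \<le> 8/3 * ln (1 / (h * c))"
    using integral_unique[OF I] by simp
qed

text \<open>The bounded and the quadratically decaying estimate combine to linear decay of the
  kernel; with the factor \<open>1 / w\<close> this yields an elementary integrable majorant. One
  factor 2 comes from that combination, the other from Re w + \<bar>Im w\<bar> \<le> 2
  \<bar>w\<bar>.\<close>

lemma norm_perron_kernel_div_le:
  assumes "0 < h" "0 < Re w" "(L + 2 * h) * Re w \<le> 1"
  shows "norm (perron_kernel L h w / w) \<le> 4 * exp 1 / ((Re w + \<bar>Im w\<bar>) * (1 + h * \<bar>Im w\<bar>))"
proof -
  let ?k = "norm (perron_kernel L h w)"
  have w: "0 < norm w" "Re w \<le> norm w" "\<bar>Im w\<bar> \<le> norm w"
    using assms complex_Re_le_cmod abs_Im_le_cmod by auto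
  have e: "exp (L * Re w + 2 * h * \<bar>Re w\<bar>) \<le> exp 1"
    using assms by (simp add: algebra_simps)
  have k: "?k \<le> exp 1" "?k * (h * norm w)\<^sup>2 \<le> exp 1"
    using norm_perron_kernel_le[OF \<open>0 < h\<close>, of L w] e by linarith+
  \<comment> \<open>The inequality 2 x \<le> 1 + x^2 for x = \<open>h * norm w\<close> interpolates
    between the two bounds in \<open>k\<close>.\<close>
  have "?k * (h * norm w) \<le> ?k * (1 + (h * norm w)\<^sup>2) / 2 "
    using sum_squares_bound[of 1 "h * norm w"] mult_left_mono[of "2 * (h * norm w)" "1 + (h * norm w)\<^sup>2" ?k]
    by simp
  also have "\<dots> \<le> exp 1"
    using k by (simp add: algebra_simps)
  finally have "?k * (1 + h * norm w) \<le> 2 * exp 1"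
    using k by (simp add: algebra_simps)
  moreover have "?k * (1 + h * \<bar>Im w\<bar>) \<le> ?k * (1 + h * norm w)"
    using assms w by (intro mult_left_mono add_left_mono) auto
  ultimately have "?k * (1 + h * \<bar>Im w\<bar>) \<le> 2 * exp 1"
    by linarith
  then have "(?k * (1 + h * \<bar>Im w\<bar>)) * (Re w + \<bar>Im w\<bar>) \<le> (2 * exp 1) * (2 * norm w)"
    by (rule mult_mono) (use assms w in auto)
  then have "?k * ((Re w + \<bar>Im w\<bar>) * (1 + h * \<bar>Im w\<bar>)) \<le> 4 * exp 1 * norm w"
    by (simp add: mult_ac)
  moreover have "0 < (Re w + \<bar>Im w\<bar>) * (1 + h * \<bar>Im w\<bar>)"
    using assms by (intro mult_pos_pos add_pos_nonneg) auto
  ultimately show ?thesis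
    unfolding norm_divide using w(1) by (simp only: pos_divide_le_eq times_divide_eq_left pos_le_divide_eq)
qed

text \<open>The constant is the product of \<open>4 * exp 1\<close> from the pointwise bound and
  \<open>8/3\<close> from its integral. The estimate is free of \<open>T\<close>, so it survives the
  limit of infinite height.\<close>

lemma norm_perron_line_integral_le:
  assumes "0 < c" "0 < h" "h * c \<le> 1/4" "(L + 2 * h) * c \<le> 1" "0 < T"
    and M: "\<And>w. Re w = c \<Longrightarrow> norm (F w) \<le> M" and cont: "continuous_on {w. 0 < Re w} F"
  shows "norm (contour_integral (linepath (Complex c (-T)) (Complex c T))
      (\<lambda>w. F w * perron_kernel L h w / w)) \<le> 32/3 * exp 1 * M * ln (1 / (h * c))"
proof -
  let ?G = "\<lambda>w. F w * perron_kernel L h w / w"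
  let ?j = "\<lambda>t. 1 / ((c + \<bar>t\<bar>) * (1 + h * \<bar>t\<bar>))"
  have M0: "0 \<le> M"
    using order_trans[OF norm_ge_zero M[of "of_real c"]] by simp
  have "continuous_on {w. 0 < Re w} ?G"
    by (intro continuous_intros cont holomorphic_on_imp_continuous_on holomorphic_perron_kernel) auto
  then have "continuous_on {-T..T} (\<lambda>t. ?G (Complex c t))"
    by (rule continuous_on_compose2) (use assms in \<open>auto simp: Complex_eq intro!: continuous_intros\<close>)
  then have int: "(\<lambda>t. ?G (Complex c t)) integrable_on {-T..T}"
    by (rule integrable_continuous_interval)
  have "norm (contour_integral (linepath (Complex c (-T)) (Complex c T)) ?G)
      = norm (integral {-T..T} (\<lambda>t. ?G (Complex c t)))"
    using assms by (subst contour_integral_linepath_same_Re[where c = c and a = "-T" and b = T])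
      (auto simp: norm_mult)
  also have "\<dots> \<le> integral {-T..T} (\<lambda>t. 4 * exp 1 * M * ?j t)"
  proof (rule integral_norm_bound_integral[OF int])
    show "(\<lambda>t. 4 * exp 1 * M * ?j t) integrable_on {-T..T}"
      using integral_perron_majorant(1)[of c h T] assms by (intro integrable_on_mult_right) auto
    fix t
    have "norm (?G (Complex c t)) = norm (F (Complex c t)) * norm (perron_kernel L h (Complex c t) / Complex c t)"
      by (simp add: norm_mult norm_divide)
    also have "\<dots> \<le> M * (4 * exp 1 * ?j t)"
      using norm_perron_kernel_div_le[of h "Complex c t" L] M[of "Complex c t"] M0 assms
      by (intro mult_mono) auto
    finally show "norm (?G (Complex c t)) \<le> 4 * exp 1 * M * ?j t"
      by (simp add: mult_ac)
  qed
  also have "\<dots> = 4 * exp 1 * M * integral {-T..T} ?j"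
    by (rule integral_mult_right)
  also have "\<dots> \<le> 4 * exp 1 * M * (8/3 * ln (1 / (h * c)))"
    using integral_perron_majorant(2)[of c h T] M0 assms by (intro mult_left_mono) auto
  finally show ?thesis by simp
qed

section \<open>Convergence and tails of Dirichlet series\<close>

lemma dirichlet_term_shift:
  "dirichlet_term lam a (s + w) n = dirichlet_term lam a s n * exp (- (of_real (lam n) * w))"
  by (simp add: dirichlet_term_def ring_distribs mult.assoc flip: exp_add)

lemma norm_dirichlet_term:
  "norm (dirichlet_term lam a s n) = norm (a n) * exp (- lam n * Re s)"
  by (simp add: dirichlet_term_def norm_mult)

text \<open>Abel summation with the constant block bound \<open>A\<close> at \<open>s0\<close>. The
  factor \<open>norm z / Re z\<close> from \<open>norm_exp_diff_le\<close> is the usual price of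
  moving to the right within an angle.\<close>

lemma norm_dirichlet_block_le:
  assumes lam: "frequency lam" and A: "\<And>m n. norm (\<Sum>k=m..n. dirichlet_term lam a s0 k) \<le> A"
    and z: "0 < Re z" and "m \<le> n"
  shows "norm (\<Sum>k=m..n. dirichlet_term lam a (s0 + z) k) \<le> A * (norm z / Re z) * exp (- lam m * Re z)"
  unfolding dirichlet_term_shift
proof (rule norm_sum_mult_le_Abel[where \<beta> = "\<lambda>_. A"
      and v = "\<lambda>k. A * (norm z / Re z) * exp (- lam k * Re z)"])
  \<comment> \<open>The block \<open>{1..0}\<close> is empty, so its bound says that
    \<open>A\<close> is non-negative.\<close>
  have "0 \<le> A" using A[of 1 0] by simp
  fix k
  have "lam k \<le> lam (Suc k)"
    using lam by (auto simp: frequency_def strict_mono_Suc_iff less_imp_le)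
  then have "A * norm (exp (- (of_real (lam k) * z)) - exp (- (of_real (lam (Suc k)) * z)))
      \<le> A * (norm z / Re z * (exp (- lam k * Re z) - exp (- lam (Suc k) * Re z)))"
    using \<open>0 \<le> A\<close> z by (intro mult_left_mono norm_exp_diff_le)
  then show "A * norm (exp (- (of_real (lam k) * z)) - exp (- (of_real (lam (Suc k)) * z)))
      \<le> A * (norm z / Re z) * exp (- lam k * Re z) - A * (norm z / Re z) * exp (- lam (Suc k) * Re z)"
    by (simp add: algebra_simps)
  have "1 \<le> norm z / Re z"
    using z complex_Re_le_cmod[of z] by simp
  then have "A * exp (- lam k * Re z) * 1 \<le> A * exp (- lam k * Re z) * (norm z / Re z)"
    using \<open>0 \<le> A\<close> by (intro mult_left_mono) auto
  then show "A * norm (exp (- (of_real (lam k) * z))) \<le> A * (norm z / Re z) * exp (- lam k * Re z)"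
    by (simp add: mult_ac)
qed (use assms in auto)

lemma frequency_mono: "frequency lam \<Longrightarrow> m \<le> n \<Longrightarrow> lam m \<le> lam n"
  by (simp add: frequency_def strict_mono_less_eq)

lemma exp_frequency_tendsto_0:
  assumes "frequency lam" "0 < x"
  shows "(\<lambda>n. exp (- lam n * x)) \<longlonglongrightarrow> 0"
proof -
  have "filterlim (\<lambda>n. lam n * x) at_top sequentially"
    using assms by (intro filterlim_at_top_mult_tendsto_pos[OF tendsto_const]) (auto simp: frequency_def mult.commute)
  then show ?thesis
    by (auto intro!: filterlim_compose[OF exp_at_bot] simp: filterlim_uminus_at_top)
qed

lemma sum_atMost_eq_lessThan_plus:
  fixes f :: "nat \<Rightarrow> 'a::ab_group_add"
  shows "m \<le> n \<Longrightarrow> sum f {..n} = sum f {..<m} + sum f {m..n}"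
  by (metis ivl_disj_un_one(4) sum.union_disjoint finite_lessThan finite_atLeastAtMost ivl_disj_int_one(4))

lemma dirichlet_blocks_bounded:
  assumes "dirichlet_converges_at lam a s0"
  obtains A where "\<And>m n. norm (\<Sum>k=m..n. dirichlet_term lam a s0 k) \<le> A"
proof -
  obtain P where P: "\<And>n. norm (\<Sum>k<n. dirichlet_term lam a s0 k) \<le> P"
    using summable_imp_sums_bounded[of "dirichlet_term lam a s0"] assms
    by (auto simp: dirichlet_converges_at_def bounded_iff)
  have "0 \<le> P" using P[of 0] by simp
  have "norm (\<Sum>k=m..n. dirichlet_term lam a s0 k) \<le> P + P" for m n
  proof (cases "m \<le> n")
    case True
    have "(\<Sum>k=m..n. dirichlet_term lam a s0 k)
        = (\<Sum>k<Suc n. dirichlet_term lam a s0 k) - (\<Sum>k<m. dirichlet_term lam a s0 k)"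
      using sum_atMost_eq_lessThan_plus[OF True, of "dirichlet_term lam a s0"] by (simp add: lessThan_Suc_atMost)
    then show ?thesis
      using P[of "Suc n"] P[of m] norm_triangle_ineq4 order_trans add_mono by metis
  qed (use \<open>0 \<le> P\<close> in auto)
  then show ?thesis by (rule that)
qed

text \<open>The classical half-plane of convergence: the block bound tends to 0 with the starting
  index, so the partial sums are Cauchy.\<close>

lemma dirichlet_converges_right:
  assumes lam: "frequency lam" and "dirichlet_converges_at lam a s0" and z: "0 < Re z"
  shows "dirichlet_converges_at lam a (s0 + z)"
proof -
  obtain A where A: "\<And>m n. norm (\<Sum>k=m..n. dirichlet_term lam a s0 k) \<le> A"
    using dirichlet_blocks_bounded[OF assms(2)] by blast
  have A0: "0 \<le> A" using A[of 1 0] by simp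
  let ?g = "\<lambda>m. A * (norm z / Re z) * exp (- lam m * Re z)"
  show ?thesis unfolding dirichlet_converges_at_def
  proof (rule summable_Cauchy'[where g = ?g])
    show "\<forall>\<^sub>F m in sequentially. \<forall>n\<ge>m. norm (sum (dirichlet_term lam a (s0 + z)) {m..<n}) \<le> ?g m"
    proof (intro always_eventually allI impI)
      fix m n :: nat assume "m \<le> n"
      show "norm (sum (dirichlet_term lam a (s0 + z)) {m..<n}) \<le> ?g m"
      proof (cases "m = n")
        case False
        then have "{m..<n} = {m..n - 1}" "m \<le> n - 1" using \<open>m \<le> n\<close> by auto
        then show ?thesis using norm_dirichlet_block_le[OF lam A z, of m "n - 1"] by simp
      qed (use A0 z in auto)
    qed
    show "?g \<longlonglongrightarrow> 0"
      using tendsto_mult_left[OF exp_frequency_tendsto_0[OF lam z], of "A * (norm z / Re z)"] by simp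
  qed
qed

text \<open>Let the upper end of a block tend to infinity. The decay rate is
  \<open>lam (Suc N)\<close>, the first frequency left out.\<close>

lemma norm_dirichlet_tail_le:
  assumes lam: "frequency lam" and A: "\<And>m n. norm (\<Sum>k=m..n. dirichlet_term lam a s0 k) \<le> A"
    and conv: "dirichlet_converges_at lam a s0" and z: "0 < Re z"
  shows "norm (suminf (dirichlet_term lam a (s0 + z)) - (\<Sum>n\<le>N. dirichlet_term lam a (s0 + z) n))
    \<le> A * (norm z / Re z) * exp (- lam (Suc N) * Re z)"
proof (rule tendsto_upperbound)
  let ?f = "dirichlet_term lam a (s0 + z)"
  have "(\<lambda>n. sum ?f {..n}) \<longlonglongrightarrow> suminf ?f"
    using dirichlet_converges_right[OF lam conv z] summable_LIMSEQ'
    by (auto simp: dirichlet_converges_at_def)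
  then show "(\<lambda>n. norm (sum ?f {..n} - sum ?f {..N})) \<longlonglongrightarrow> norm (suminf ?f - sum ?f {..N})"
    by (intro tendsto_intros)
  show "\<forall>\<^sub>F n in sequentially. norm (sum ?f {..n} - sum ?f {..N})
      \<le> A * (norm z / Re z) * exp (- lam (Suc N) * Re z)"
    using eventually_ge_at_top[of "Suc N"]
  proof eventually_elim
    case (elim n)
    then have "sum ?f {..n} - sum ?f {..N} = sum ?f {Suc N..n}"
      using sum_atMost_eq_lessThan_plus[OF elim, of ?f] by (simp add: lessThan_Suc_atMost)
    then show ?case using norm_dirichlet_block_le[OF lam A z elim] by simp
  qed
qed simp

text \<open>Far to the right \<open>f\<close> is the sum of the series and the tail bound applies.
  In the remaining strip \<open>Re w\<close> is bounded, so \<open>exp (- l * Re w)\<close> is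
  bounded below and the boundedness of \<open>f\<close> suffices. The constant \<open>K\<close> may
  depend on \<open>s\<close>, \<open>N\<close> and \<open>l\<close>: it only enters an error that
  vanishes in the limit.\<close>

lemma dirichlet_tail_growth:
  assumes lam: "frequency lam" and conv: "dirichlet_converges_at lam a s0"
    and ext: "bounded_extension lam a f" and M: "\<And>s. 0 < Re s \<Longrightarrow> norm (f s) \<le> M"
    and s: "0 < Re s" and l: "0 \<le> l" "l \<le> lam (Suc N)"
  obtains K where "0 \<le> K"
    and "\<And>w. 0 \<le> Re w \<Longrightarrow> norm (f (s + w) - (\<Sum>n\<le>N. dirichlet_term lam a (s + w) n))
      \<le> K * (1 + norm w) * exp (- l * Re w)"
proof -
  obtain A where A: "\<And>m n. norm (\<Sum>k=m..n. dirichlet_term lam a s0 k) \<le> A"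
    using dirichlet_blocks_bounded[OF conv] by blast
  have A0: "0 \<le> A" using A[of 1 0] by simp
  have M0: "0 \<le> M" using order_trans[OF norm_ge_zero M[OF s]] .
  \<comment> \<open>The summand 1 ensures \<open>Re z\<close> \<ge> 1 in the first case below, so
    dividing by \<open>Re z\<close> costs nothing.\<close>
  define \<sigma> where "\<sigma> = \<bar>Re s0\<bar> + 1"
  define K1 where "K1 = A * (norm (s - s0) + 1) * exp (- l * Re (s - s0))"
  define K2 where "K2 = (M + (\<Sum>n\<le>N. norm (a n))) * exp (l * \<sigma>)"
  have K: "0 \<le> K1" "0 \<le> K2"
    using A0 M0 by (auto simp: K1_def K2_def intro!: mult_nonneg_nonneg add_nonneg_nonneg sum_nonneg)
  have "norm (f (s + w) - (\<Sum>n\<le>N. dirichlet_term lam a (s + w) n))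
      \<le> (K1 + K2) * (1 + norm w) * exp (- l * Re w)" if w: "0 \<le> Re w" for w
  proof (cases "\<sigma> \<le> Re (s + w)")
    case True
    define z where "z = s + w - s0"
    have sz: "s0 + z = s + w" by (simp add: z_def)
    have z: "1 \<le> Re z" using True by (simp add: z_def \<sigma>_def)
    \<comment> \<open>An extension is identified with the sum only on half-planes where the series
      converges throughout; the one to the right of \<open>s0\<close> serves.\<close>
    have "dirichlet_converges_at lam a u" if "u \<in> right_half_plane (Re s0)" for u
      using dirichlet_converges_right[OF lam conv, of "u - s0"] that by (simp add: right_half_plane_def)
    moreover have "s + w \<in> right_half_plane (Re s0) \<inter> right_half_plane 0"
      using True w s by (auto simp: right_half_plane_def \<sigma>_def)
    ultimately have "f (s + w) = suminf (dirichlet_term lam a (s + w))"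
      using ext unfolding bounded_extension_def by blast
    then have "norm (f (s + w) - (\<Sum>n\<le>N. dirichlet_term lam a (s + w) n))
        \<le> A * (norm z / Re z) * exp (- lam (Suc N) * Re z)"
      using norm_dirichlet_tail_le[OF lam A conv, of z N] z unfolding sz by simp
    also have "\<dots> \<le> A * ((norm (s - s0) + 1) * (1 + norm w)) * exp (- l * Re z)"
    proof (intro mult_mono mult_left_mono A0)
      have "norm z / Re z \<le> norm z"
        using z divide_left_mono[of 1 "Re z" "norm z"] by simp
      also have "\<dots> \<le> norm (s - s0) + norm w"
        unfolding z_def using norm_triangle_ineq[of "s - s0" w] by (simp add: algebra_simps)
      also have "\<dots> \<le> (norm (s - s0) + 1) * (1 + norm w)"
        by (simp add: algebra_simps)
      finally show "norm z / Re z \<le> (norm (s - s0) + 1) * (1 + norm w)" .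
      show "exp (- lam (Suc N) * Re z) \<le> exp (- l * Re z)"
        using l z by (simp add: mult_right_mono)
    qed (use A0 z in auto)
    also have "\<dots> = K1 * (1 + norm w) * exp (- l * Re w)"
      by (simp add: K1_def z_def algebra_simps flip: exp_add)
    also have "\<dots> \<le> (K1 + K2) * (1 + norm w) * exp (- l * Re w)"
      using K by (intro mult_right_mono) auto
    finally show ?thesis .
  next
    case False
    have "norm (dirichlet_term lam a (s + w) n) \<le> norm (a n)" for n
      using lam s w by (simp add: norm_dirichlet_term frequency_def mult_left_le)
    then have "norm (f (s + w) - (\<Sum>n\<le>N. dirichlet_term lam a (s + w) n))
        \<le> M + (\<Sum>n\<le>N. norm (a n))"
      using s w by (intro order_trans[OF norm_triangle_ineq4] add_mono M sum_norm_le) auto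
    also have "\<dots> = K2 * exp (- l * \<sigma>)"
      by (simp add: K2_def flip: exp_add)
    also have "\<dots> \<le> (K1 + K2) * (1 + norm w) * exp (- l * Re w)"
    proof (intro mult_mono)
      have "K2 * 1 \<le> (K1 + K2) * (1 + norm w)"
        using K by (intro mult_mono) auto
      then show "K2 \<le> (K1 + K2) * (1 + norm w)" by simp
      show "exp (- l * \<sigma>) \<le> exp (- l * Re w)"
        using False s l by (simp add: mult_left_mono)
    qed (use K in auto)
    finally show ?thesis .
  qed
  then show ?thesis using K by (intro that[of "K1 + K2"]) auto
qed

section \<open>The estimate of a partial sum by the bounded extension\<close>

lemma le_if_le_add_inverse:
  fixes x y :: real
  assumes "\<And>T. T0 < T \<Longrightarrow> x \<le> y + C / T"
  shows "x \<le> y"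
proof (rule tendsto_lowerbound)
  show "((\<lambda>T. y + C / T) \<longlongrightarrow> y) at_top"
    by real_asymp
  show "\<forall>\<^sub>F T in at_top. x \<le> y + C / T"
    using eventually_gt_at_top[of T0] by eventually_elim (rule assms)
qed simp

text \<open>The constant is that of \<open>norm_perron_line_integral_le\<close> divided by 2 pi. The
  end \<open>l\<close> of the cut-off stays free so that a convenient point of the gap after
  \<open>lam N\<close> can be chosen later.\<close>

lemma dirichlet_partial_sum_bound:
  assumes lam: "frequency lam" and conv: "dirichlet_converges_at lam a s0"
    and ext: "bounded_extension lam a f" and M: "\<And>s. 0 < Re s \<Longrightarrow> norm (f s) \<le> M"
    and s: "0 < Re s" and l: "lam N < l" "l \<le> lam (Suc N)"
  shows "norm (\<Sum>n\<le>N. dirichlet_term lam a s n) \<le> 16 / (3 * pi) * exp 1 * M * ln (4 * l / (l - lam N))"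
proof -
  \<comment> \<open>These values place the support of the density on \<open>{lam N..l}\<close>; with
    \<open>c = 1 / l\<close> the exponential growth of the kernel on the line is
    \<open>exp 1\<close>.\<close>
  define L h c where "L = (l + lam N) / 2" and "h = (l - lam N) / 4" and "c = 1 / l"
  have lN: "0 \<le> lam N" using lam by (simp add: frequency_def)
  have pos: "0 < l" "0 < h" "0 < c" using l lN by (auto simp: h_def c_def)
  have hc: "h * c \<le> 1/4" using lN pos by (simp add: h_def c_def field_simps)
  have Lh: "L + 2 * h = l" "L - 2 * h = lam N"
    by (simp_all add: L_def h_def field_simps)
  define k where "k = perron_kernel L h"
  define F where "F = (\<lambda>w. f (s + w))"
  define S where "S = (\<lambda>w. \<Sum>n\<le>N. dirichlet_term lam a (s + w) n)"
  have holo_k: "k holomorphic_on X" for X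
    unfolding k_def by (rule holomorphic_perron_kernel)
  have holo_S: "S holomorphic_on X" for X
    unfolding S_def dirichlet_term_def by (intro holomorphic_intros)
  have "f holomorphic_on {w. 0 < Re w}"
    using ext by (simp add: bounded_extension_def right_half_plane_def)
  then have holo_F: "F holomorphic_on {w. 0 < Re w}"
    unfolding F_def using s
    by (intro holomorphic_on_compose_gen[unfolded o_def, of "\<lambda>w. s + w" _ f "{w. 0 < Re w}"])
      (auto intro!: holomorphic_intros)
  obtain K where K: "0 \<le> K" "\<And>w. 0 \<le> Re w \<Longrightarrow> norm (F w - S w) \<le> K * (1 + norm w) * exp (- l * Re w)"
    using dirichlet_tail_growth[OF lam conv ext M s _ l(2)] pos unfolding F_def S_def by (metis less_imp_le)
  have kernel: "norm (k w) * (h * norm w)\<^sup>2 \<le> exp (L * Re w + 2 * h * \<bar>Re w\<bar>)" for w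
    unfolding k_def by (rule norm_perron_kernel_le(2)[OF pos(2)])
  define A where "A = exp 1 * (\<Sum>n\<le>N. norm (a n))"
  have A0: "0 \<le> A" by (auto simp: A_def intro!: mult_nonneg_nonneg sum_nonneg)
  \<comment> \<open>For \<open>Re w < 0\<close> the kernel decays like
    \<open>exp (lam N * Re w)\<close>, which outweighs the growth of every term with index at most
    \<open>N\<close>; for \<open>Re w\<close> between 0 and \<open>c\<close> the exponent is at most
    \<open>l * c = 1\<close>. The quadratic decay in \<open>w\<close> remains.\<close>
  have left: "norm (S w * k w / w) \<le> A / (h\<^sup>2 * T ^ 2)"
    if w: "Re w \<le> c" "T \<le> norm w" and T: "1 \<le> T" for w T
  proof -
    have w0: "w \<noteq> 0" using w T by auto
    have summand: "norm (dirichlet_term lam a (s + w) n) * exp (L * Re w + 2 * h * \<bar>Re w\<bar>) \<le> norm (a n) * exp 1"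
      if "n \<le> N" for n
    proof -
      have n: "0 \<le> lam n" "lam n \<le> lam N"
        using lam frequency_mono[OF lam that] by (auto simp: frequency_def)
      have "L * Re w + 2 * h * \<bar>Re w\<bar> \<le> 1 + lam n * Re w"
      proof (cases "0 \<le> Re w")
        case True
        have "L * Re w + 2 * h * \<bar>Re w\<bar> = l * Re w"
          using True unfolding Lh(1)[symmetric] by (simp add: algebra_simps)
        also have "\<dots> \<le> l * c" using w pos by (intro mult_left_mono) auto
        also have "\<dots> \<le> 1 + lam n * Re w" using True n pos by (simp add: c_def)
        finally show ?thesis .
      next
        case False
        then have "L * Re w + 2 * h * \<bar>Re w\<bar> = lam N * Re w"
          unfolding Lh(2)[symmetric] by (simp add: algebra_simps)
        also have "\<dots> \<le> lam n * Re w" using False n by (intro mult_right_mono_neg) auto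
        finally show ?thesis by simp
      qed
      moreover have "0 \<le> lam n * Re s" using n s by simp
      ultimately have "exp (- lam n * Re (s + w)) * exp (L * Re w + 2 * h * \<bar>Re w\<bar>) \<le> exp 1"
        unfolding exp_add[symmetric] exp_le_cancel_iff plus_complex.sel by (simp only: ring_distribs mult_minus_left)
      then show ?thesis
        by (simp add: norm_dirichlet_term mult_left_mono mult.assoc)
    qed
    have "norm (S w) * exp (L * Re w + 2 * h * \<bar>Re w\<bar>)
        \<le> (\<Sum>n\<le>N. norm (dirichlet_term lam a (s + w) n)) * exp (L * Re w + 2 * h * \<bar>Re w\<bar>)"
      unfolding S_def by (intro mult_right_mono norm_sum) auto
    also have "\<dots> \<le> (\<Sum>n\<le>N. norm (a n) * exp 1)"
      unfolding sum_distrib_right by (intro sum_mono summand) auto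
    finally have "norm (S w) * exp (L * Re w + 2 * h * \<bar>Re w\<bar>) \<le> A"
      by (simp add: A_def sum_distrib_left mult.commute)
    then have "norm (S w) * (norm (k w) * (h * norm w)\<^sup>2) \<le> A"
      using mult_left_mono[OF kernel[of w] norm_ge_zero[of "S w"]] by linarith
    then have kA: "norm (S w) * norm (k w) \<le> A / (h * norm w)\<^sup>2"
      using pos w T by (subst pos_le_divide_eq) (auto simp: mult.assoc)
    have "norm (S w * k w / w) \<le> norm (S w) * norm (k w) / 1"
      unfolding norm_divide norm_mult using w T by (intro divide_left_mono) auto
    also have "\<dots> \<le> A / (h * norm w)\<^sup>2" using kA by simp
    also have "\<dots> \<le> A / (h * T)\<^sup>2"
      using pos w T A0 w0 by (intro divide_left_mono power_mono mult_left_mono mult_pos_pos zero_less_power) auto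
    finally show ?thesis by (simp add: power_mult_distrib)
  qed
  \<comment> \<open>The decay \<open>exp (- l * Re w)\<close> of the remainder cancels the growth of
    the kernel, and its linear growth is absorbed by \<open>1 / w\<close>, so the quadratic decay
    remains here as well.\<close>
  have right: "norm ((F w - S w) * k w / w) \<le> 2 * K / (h\<^sup>2 * T ^ 2)"
    if w: "0 < Re w" "T \<le> norm w" and T: "1 \<le> T" for w T
  proof -
    have w0: "w \<noteq> 0" using w T by auto
    have e: "exp (L * Re w + 2 * h * \<bar>Re w\<bar>) = exp (l * Re w)"
      using w unfolding Lh(1)[symmetric] by (simp add: algebra_simps)
    have "norm (F w - S w) * (norm (k w) * (h * norm w)\<^sup>2)
        \<le> (K * (1 + norm w) * exp (- l * Re w)) * exp (l * Re w)"
      using K(2)[of w] kernel[of w] w K(1) unfolding e by (intro mult_mono) auto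
    also have "\<dots> = K * (1 + norm w)"
      by (simp add: mult.assoc flip: exp_add)
    also have "\<dots> \<le> 2 * K * norm w"
      using K w T mult_left_mono[of "1 + norm w" "2 * norm w" K] by simp
    finally have kK: "norm (F w - S w) * norm (k w) \<le> 2 * K * norm w / (h * norm w)\<^sup>2"
      using pos w T by (subst pos_le_divide_eq) (auto simp: mult.assoc)
    have "norm ((F w - S w) * k w / w) \<le> (2 * K * norm w / (h * norm w)\<^sup>2) / norm w"
      unfolding norm_divide norm_mult using kK by (intro divide_right_mono) auto
    also have "\<dots> = 2 * K / (h * norm w)\<^sup>2"
      using w T by auto
    also have "\<dots> \<le> 2 * K / (h * T)\<^sup>2"
      using pos w T K w0 by (intro divide_left_mono power_mono mult_left_mono mult_pos_pos zero_less_power) auto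
    finally show ?thesis by (simp add: power_mult_distrib)
  qed
  have norm_diff_diff_le: "norm (x - y - z) \<le> norm x + norm y + norm z" for x y z :: complex
    using norm_triangle_ineq4[of "x - y" z] norm_triangle_ineq4[of x y] by linarith
  have "2 * pi * norm (S 0) \<le> 32/3 * exp 1 * M * ln (1 / (h * c)) + ((6 * A + 8 * K) / h\<^sup>2) / T"
    if T: "max 1 c < T" for T
  proof -
    let ?V = "linepath (Complex c (-T)) (Complex c T)"
    have T': "1 \<le> T" "c < T" "0 < T" using T by auto
    have seg: "closed_segment (Complex c (-T)) (Complex c T) \<subseteq> {w. 0 < Re w}"
      using pos T' by (auto simp: closed_segment_same_Re)
    have cont: "continuous_on {w. 0 < Re w} F" "continuous_on {w. 0 < Re w} S" "continuous_on {w. 0 < Re w} k"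
      using holo_F holo_S holo_k holomorphic_on_imp_continuous_on by blast+
    have int: "(\<lambda>w. G w * k w / w) contour_integrable_on ?V" if "continuous_on {w. 0 < Re w} G" for G
    proof -
      have "continuous_on {w. 0 < Re w} (\<lambda>w. G w * k w / w)"
        by (intro continuous_intros that cont) auto
      from continuous_on_subset[OF this seg] show ?thesis
        by (rule contour_integrable_continuous_linepath)
    qed
    have "(\<lambda>w. F w * k w / w) = (\<lambda>w. S w * k w / w + (F w - S w) * k w / w)"
      by (simp add: fun_eq_iff left_diff_distrib flip: add_divide_distrib)
    then have "contour_integral ?V (\<lambda>w. F w * k w / w) = contour_integral ?V (\<lambda>w. S w * k w / w)
        + contour_integral ?V (\<lambda>w. (F w - S w) * k w / w)"
      using contour_integral_add[OF int[OF cont(2)] int[OF continuous_on_diff[OF cont(1,2)]]]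
      by simp
    \<comment> \<open>Since \<open>k 0 = 1\<close>, the pole at 0 returns the unsmoothed partial sum
      \<open>S 0\<close> at the point \<open>s\<close>.\<close>
    then have eq: "2 * of_real pi * \<i> * S 0 = contour_integral ?V (\<lambda>w. F w * k w / w)
        - contour_integral ?V (\<lambda>w. (F w - S w) * k w / w)
        - (contour_integral ?V (\<lambda>w. S w * k w / w) - 2 * of_real pi * \<i> * (S 0 * k 0))"
      by (simp add: k_def)
    have "2 * pi * norm (S 0) = norm (2 * of_real pi * \<i> * S 0)"
      by (simp add: norm_mult)
    also have "\<dots> \<le> norm (contour_integral ?V (\<lambda>w. F w * k w / w))
        + norm (contour_integral ?V (\<lambda>w. (F w - S w) * k w / w))
        + norm (contour_integral ?V (\<lambda>w. S w * k w / w) - 2 * of_real pi * \<i> * (S 0 * k 0))"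
      unfolding eq by (rule norm_diff_diff_le)
    \<comment> \<open>Both closing errors are an integrand of order \<open>1 / T ^ 2\<close> times a
      length of order \<open>T\<close>, hence vanish as \<open>T\<close> grows.\<close>
    also have "\<dots> \<le> 32/3 * exp 1 * M * ln (1 / (h * c)) + 2 * K / (h\<^sup>2 * T ^ 2) * (4 * T) + A / (h\<^sup>2 * T ^ 2) * (6 * T)"
    proof (intro add_mono)
      show "norm (contour_integral ?V (\<lambda>w. F w * k w / w)) \<le> 32/3 * exp 1 * M * ln (1 / (h * c))"
        unfolding k_def
      proof (rule norm_perron_line_integral_le)
        show "(L + 2 * h) * c \<le> 1" unfolding Lh(1) using pos by (simp add: c_def)
        show "norm (F w) \<le> M" if "Re w = c" for w
          unfolding F_def using that s pos by (intro M) auto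
      qed (use pos hc T' cont in auto)
      show "norm (contour_integral ?V (\<lambda>w. (F w - S w) * k w / w)) \<le> 2 * K / (h\<^sup>2 * T ^ 2) * (4 * T)"
      proof (rule contour_integral_right_square)
        show "(\<lambda>w. (F w - S w) * k w / w) holomorphic_on {w. 0 < Re w}"
          by (intro holomorphic_intros holo_F holo_S holo_k) auto
      qed (use pos T' K right in auto)
      show "norm (contour_integral ?V (\<lambda>w. S w * k w / w) - 2 * of_real pi * \<i> * (S 0 * k 0))
          \<le> A / (h\<^sup>2 * T ^ 2) * (6 * T)"
      proof (rule contour_integral_left_square)
        show "(\<lambda>w. S w * k w) holomorphic_on UNIV"
          by (intro holomorphic_intros holo_S holo_k)
        show "norm (S w * k w / w) \<le> A / (h\<^sup>2 * T ^ 2)" if "Re w \<le> c" "T \<le> norm w" for w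
          using left[OF that T'(1)] .
      qed (use pos T' A0 in auto)
    qed
    also have "\<dots> = 32/3 * exp 1 * M * ln (1 / (h * c)) + ((6 * A + 8 * K) / h\<^sup>2) / T"
      using pos T' by (simp add: field_simps power2_eq_square)
    finally show ?thesis .
  qed
  then have "2 * pi * norm (S 0) \<le> 32/3 * exp 1 * M * ln (1 / (h * c))"
    by (rule le_if_le_add_inverse)
  moreover have "1 / (h * c) = 4 * l / (l - lam N)"
    by (simp add: h_def c_def)
  ultimately show ?thesis
    by (simp add: S_def field_simps)
qed

section \<open>Landau's condition and the resulting bound on partial sums\<close>

text \<open>The logarithm removes one of the two exponentials in Landau's condition: minus the
  logarithm of the gap is at most \<open>exp (\<delta> * lam N)\<close> up to a constant. The
  witness is \<open>lam N\<close> plus the gap cut at 1, which keeps \<open>ln l\<close> at most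
  \<open>lam N\<close>.\<close>

lemma landau_log_gap_bound:
  assumes lam: "frequency lam" and "landau_condition lam" and "0 < \<delta>"
  obtains C where "0 \<le> C" and "\<And>N. \<exists>l. lam N < l \<and> l \<le> lam (Suc N)
    \<and> ln (4 * l / (l - lam N)) \<le> C * exp (\<delta> * lam N)"
proof -
  obtain C0 where C0: "0 < C0" "\<And>n. C0 * exp (- exp (\<delta> * lam n)) \<le> lam (Suc n) - lam n"
    using assms unfolding landau_condition_def by blast
  \<comment> \<open>With \<open>C1\<close> \<le> 1 the lower bound also holds for the gap cut at 1,
    and \<open>ln C1\<close> is not positive.\<close>
  define C1 where "C1 = min 1 C0"
  have C1: "0 < C1" "C1 \<le> 1" "C1 \<le> C0" using C0 by (auto simp: C1_def)
  define C where "C = ln 4 + 1 / \<delta> - ln C1 + 1"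
  have lnC1: "ln C1 \<le> 0" using C1 by simp
  have "\<exists>l. lam N < l \<and> l \<le> lam (Suc N)
    \<and> ln (4 * l / (l - lam N)) \<le> C * exp (\<delta> * lam N)" for N
  proof -
    define g where "g = min 1 (lam (Suc N) - lam N)"
    define E where "E = exp (\<delta> * lam N)"
    have lN: "0 \<le> lam N" "lam N < lam (Suc N)"
      using lam by (auto simp: frequency_def strict_mono_Suc_iff)
    \<comment> \<open>The first fact lets \<open>E\<close> absorb additive constants; the second
      lets \<open>E / \<delta>\<close> absorb \<open>lam N\<close>.\<close>
    have E: "1 \<le> E" "\<delta> * lam N \<le> E"
      using lN \<open>0 < \<delta>\<close> exp_ge_add_one_self[of "\<delta> * lam N"] unfolding E_def by (auto simp del: exp_ge_add_one_self)
    have g: "0 < g" "g \<le> 1" using lN by (auto simp: g_def)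
    have "C1 * exp (- E) \<le> g"
      unfolding g_def
    proof (rule min.boundedI)
      have "C1 * exp (- E) \<le> 1 * 1" using C1 E by (intro mult_mono) auto
      then show "C1 * exp (- E) \<le> 1" by simp
      have "C1 * exp (- E) \<le> C0 * exp (- E)" using C1 by (intro mult_right_mono) auto
      also have "\<dots> \<le> lam (Suc N) - lam N" using C0(2)[of N] by (simp add: E_def)
      finally show "C1 * exp (- E) \<le> lam (Suc N) - lam N" .
    qed
    then have "ln (C1 * exp (- E)) \<le> ln g" using C1 g by (subst ln_le_cancel_iff) auto
    then have lng: "ln C1 - E \<le> ln g" using C1 by (simp add: ln_mult)
    have "ln (lam N + g) \<le> lam N + g - 1" using lN g by (intro ln_le_minus_one) auto
    also have "\<dots> \<le> lam N" using g by simp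
    also have "\<dots> \<le> 1 / \<delta> * E" using E \<open>0 < \<delta>\<close> by (simp add: field_simps)
    finally have "ln 4 + ln (lam N + g) - ln g \<le> ln 4 + 1 / \<delta> * E - ln C1 + E"
      using lng by simp
    also have "\<dots> \<le> ln 4 * E + 1 / \<delta> * E - ln C1 * E + E"
    proof -
      have "ln 4 * 1 \<le> ln 4 * E"
        using E by (intro mult_left_mono) auto
      moreover have "ln C1 * E \<le> ln C1 * 1"
        using E lnC1 by (intro mult_left_mono_neg) auto
      ultimately show ?thesis by linarith
    qed
    also have "\<dots> = C * E" by (simp add: C_def algebra_simps)
    finally have "ln 4 + ln (lam N + g) - ln g \<le> C * E" .
    moreover have ln_eq: "ln (4 * x / g) = ln 4 + ln x - ln g" if "0 < x" for x
      using g that by (simp add: ln_div ln_mult)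
    moreover have "0 < lam N + g" using lN g by simp
    ultimately have "ln (4 * (lam N + g) / g) \<le> C * E"
      by (simp only: ln_eq)
    then show ?thesis
      using g lN unfolding E_def by (intro exI[of _ "lam N + g"]) (auto simp: g_def)
  qed
  moreover have "0 \<le> C"
  proof -
    have "0 \<le> ln (4 :: real)" "0 \<le> 1 / \<delta>" using \<open>0 < \<delta>\<close> by auto
    then show ?thesis using lnC1 unfolding C_def by linarith
  qed
  ultimately show ?thesis using that by blast
qed

lemma D_infty_norm_upper:
  assumes "a \<in> D_infty_ext lam"
  shows "bounded_extension lam a (extension_of lam a)"
    and "0 < Re s \<Longrightarrow> norm (extension_of lam a s) \<le> D_infty_norm lam a"
proof -
  show "bounded_extension lam a (extension_of lam a)"
    using assms unfolding D_infty_ext_def extension_of_def by (simp add: some_eq_ex)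
  show "norm (extension_of lam a s) \<le> D_infty_norm lam a" if "0 < Re s"
    unfolding D_infty_norm_def using that
    by (intro cSUP_upper bdd_above_extension_of assms) (simp add: right_half_plane_def)
qed

text \<open>The constant comes from the gap bound alone, hence is fixed before the series,
  \<open>N\<close> and \<open>s\<close>.\<close>

lemma landau_partial_sum_bound:
  assumes lam: "frequency lam" and LC: "landau_condition lam" and "0 < \<delta>"
  obtains C where "0 \<le> C" and "\<And>a N s. a \<in> D_infty_ext lam \<Longrightarrow> 0 < Re s \<Longrightarrow>
    norm (\<Sum>n\<le>N. dirichlet_term lam a s n) \<le> C * exp (\<delta> * lam N) * D_infty_norm lam a"
proof -
  obtain C where C: "0 \<le> C" "\<And>N. \<exists>l. lam N < l \<and> l \<le> lam (Suc N)
    \<and> ln (4 * l / (l - lam N)) \<le> C * exp (\<delta> * lam N)"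
    using landau_log_gap_bound[OF assms] by blast
  show ?thesis
  proof (rule that[of "16 / (3 * pi) * exp 1 * C"])
    fix a N s assume a: "a \<in> D_infty_ext lam" and s: "0 < Re s"
    obtain s0 where s0: "dirichlet_converges_at lam a s0"
      using a by (auto simp: D_infty_ext_def)
    obtain l where l: "lam N < l" "l \<le> lam (Suc N)" "ln (4 * l / (l - lam N)) \<le> C * exp (\<delta> * lam N)"
      using C(2)[of N] by blast
    let ?M = "D_infty_norm lam a"
    have M: "0 \<le> ?M"
      using order_trans[OF norm_ge_zero D_infty_norm_upper(2)[OF a s]] .
    have "norm (\<Sum>n\<le>N. dirichlet_term lam a s n) \<le> 16 / (3 * pi) * exp 1 * ?M * ln (4 * l / (l - lam N))"
      by (rule dirichlet_partial_sum_bound[OF lam s0 D_infty_norm_upper[OF a] s l(1,2)])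
    also have "\<dots> \<le> 16 / (3 * pi) * exp 1 * ?M * (C * exp (\<delta> * lam N))"
      using M by (intro mult_left_mono l) auto
    finally show "norm (\<Sum>n\<le>N. dirichlet_term lam a s n)
        \<le> 16 / (3 * pi) * exp 1 * C * exp (\<delta> * lam N) * ?M"
      by (simp add: mult_ac)
  qed (use C in simp)
qed

section \<open>Uniform convergence on smaller half-planes\<close>

lemma landau_imp_bohr:
  assumes lam: "frequency lam" and LC: "landau_condition lam"
  shows "satisfies_bohr lam"
  unfolding satisfies_bohr_def
proof (intro ballI allI impI)
  fix a and \<epsilon> :: real assume a: "a \<in> D_infty_ext lam" and "0 < \<epsilon>"
  \<comment> \<open>Half of \<open>\<epsilon>\<close> pays for the growth of the block bounds; the
    other half remains as decay.\<close>
  define \<delta> where "\<delta> = \<epsilon> / 2"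
  have \<delta>: "0 < \<delta>" "\<epsilon> = \<delta> + \<delta>" using \<open>0 < \<epsilon>\<close> by (auto simp: \<delta>_def)
  obtain C0 where C0: "0 \<le> C0" "\<And>N s. 0 < Re s \<Longrightarrow>
    norm (\<Sum>n\<le>N. dirichlet_term lam a s n) \<le> C0 * exp (\<delta> * lam N) * D_infty_norm lam a"
    using landau_partial_sum_bound[OF lam LC \<delta>(1)] a by metis
  define C where "C = 2 * (C0 * D_infty_norm lam a)"
  have "0 \<le> D_infty_norm lam a"
    using order_trans[OF norm_ge_zero D_infty_norm_upper(2)[OF a, of 1]] by simp
  then have C: "0 \<le> C" using C0 by (simp add: C_def)
  \<comment> \<open>A block is a difference of two partial sums, whence the factor 2 in
    \<open>C\<close>; a block starting at 0 is itself a partial sum.\<close>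
  have block: "norm (\<Sum>k=m..n. dirichlet_term lam a s k) \<le> C * exp (\<delta> * lam n)"
    if "0 < Re s" "m \<le> n" for s m n
  proof (cases m)
    case 0
    have "norm (\<Sum>k\<le>n. dirichlet_term lam a s k) \<le> C / 2 * exp (\<delta> * lam n)"
      using C0(2)[OF that(1), of n] by (simp add: C_def mult_ac)
    also have "\<dots> \<le> C * exp (\<delta> * lam n)" using C by (intro mult_right_mono) auto
    finally show ?thesis using 0 by (simp add: atLeast0AtMost)
  next
    case (Suc p)
    have "(\<Sum>k=m..n. dirichlet_term lam a s k)
        = (\<Sum>k\<le>n. dirichlet_term lam a s k) - (\<Sum>k\<le>p. dirichlet_term lam a s k)"
      using sum_atMost_eq_lessThan_plus[OF \<open>m \<le> n\<close>, of "dirichlet_term lam a s"] Suc by (simp add: lessThan_Suc_atMost)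
    also have "norm \<dots> \<le> C / 2 * exp (\<delta> * lam n) + C / 2 * exp (\<delta> * lam p)"
      using C0(2)[OF that(1), of n] C0(2)[OF that(1), of p]
      by (intro order_trans[OF norm_triangle_ineq4] add_mono) (simp_all add: C_def mult_ac)
    also have "\<dots> \<le> C / 2 * exp (\<delta> * lam n) + C / 2 * exp (\<delta> * lam n)"
      using C \<delta> frequency_mono[OF lam, of p n] Suc that by (intro add_mono mult_left_mono) auto
    finally show ?thesis by simp
  qed
  \<comment> \<open>In terms of \<open>x\<close> the block bound grows like \<open>1 / x k\<close>
    while the weight is \<open>x k * x k\<close>. The difference of consecutive weights is at most
    \<open>2 * x k * (x k - x (Suc k))\<close>, so the product telescopes to a multiple of
    \<open>x m\<close>.\<close>
  define x where "x = (\<lambda>k. exp (- lam k * \<delta>))"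
  have x: "0 < x k" "x (Suc k) \<le> x k" "exp (\<delta> * lam k) * x k = 1" "exp (- lam k * \<epsilon>) = x k * x k" for k
    using frequency_mono[OF lam, of k "Suc k"] \<delta>
    by (auto simp: x_def algebra_simps simp flip: exp_add)
  have tail: "norm (\<Sum>k=m..n. dirichlet_term lam a s k) \<le> 2 * C * x m"
    if s: "s \<in> right_half_plane \<epsilon>" and "m \<le> n" for s m n
  proof -
    have s': "0 < Re (s - of_real \<epsilon>)" using s by (simp add: right_half_plane_def)
    \<comment> \<open>Shifting by the real number \<open>\<epsilon>\<close> leaves a point in the
      right half-plane, where the block bounds hold uniformly, and real weights independent of
      \<open>s\<close>.\<close>
    have sum: "(\<Sum>k=m..n. dirichlet_term lam a s k)
        = (\<Sum>k=m..n. dirichlet_term lam a (s - of_real \<epsilon>) k * of_real (x k * x k))"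
      using dirichlet_term_shift[of lam a "s - of_real \<epsilon>" "of_real \<epsilon>"]
      by (simp flip: x(4) exp_of_real)
    show ?thesis unfolding sum
    proof (rule norm_sum_mult_le_Abel[where \<beta> = "\<lambda>k. C * exp (\<delta> * lam k)" and v = "\<lambda>k. 2 * C * x k"])
      fix k
      have "norm (complex_of_real (x k * x k) - of_real (x (Suc k) * x (Suc k)))
          = \<bar>x k * x k - x (Suc k) * x (Suc k)\<bar>"
        by (metis norm_of_real of_real_diff)
      also have "\<dots> = (x k + x (Suc k)) * (x k - x (Suc k))"
        using x(1)[of k] x(1)[of "Suc k"] x(2)[of k] by (subst abs_of_nonneg) (auto intro!: mult_mono simp: algebra_simps)
      also have "\<dots> \<le> (2 * x k) * (x k - x (Suc k))"
        using x(2)[of k] by (intro mult_right_mono) auto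
      finally have "C * exp (\<delta> * lam k) * norm (complex_of_real (x k * x k) - of_real (x (Suc k) * x (Suc k)))
          \<le> C * exp (\<delta> * lam k) * ((2 * x k) * (x k - x (Suc k)))"
        using C by (intro mult_left_mono) auto
      also have "\<dots> = 2 * C * (exp (\<delta> * lam k) * x k) * (x k - x (Suc k))" by (simp add: mult_ac)
      finally show "C * exp (\<delta> * lam k) * norm (complex_of_real (x k * x k) - of_real (x (Suc k) * x (Suc k)))
          \<le> 2 * C * x k - 2 * C * x (Suc k)"
        unfolding x(3) by (simp add: algebra_simps)
      have "C * exp (\<delta> * lam k) * norm (complex_of_real (x k * x k)) = C * (exp (\<delta> * lam k) * x k) * x k"
        using x(1)[of k] by (simp add: norm_mult)
      also have "\<dots> \<le> 2 * C * x k"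
        unfolding x(3) using C x(1)[of k] by simp
      finally show "C * exp (\<delta> * lam k) * norm (complex_of_real (x k * x k)) \<le> 2 * C * x k" .
    qed (use block s' \<open>m \<le> n\<close> in auto)
  qed
  show "uniformly_convergent_on (right_half_plane \<epsilon>) (\<lambda>N s. \<Sum>n\<le>N. dirichlet_term lam a s n)"
  proof (intro Cauchy_uniformly_convergent uniformly_Cauchy_onI')
    fix e :: real assume "0 < e"
    have "(\<lambda>m. 2 * C * x m) \<longlonglongrightarrow> 2 * C * 0"
      unfolding x_def by (intro tendsto_mult_left exp_frequency_tendsto_0 lam \<delta>)
    then have "\<forall>\<^sub>F m in sequentially. 2 * C * x m < e"
      using \<open>0 < e\<close> by (intro order_tendstoD) auto
    then obtain M where M: "\<And>m. M \<le> m \<Longrightarrow> 2 * C * x m < e"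
      unfolding eventually_sequentially by blast
    show "\<exists>M. \<forall>s\<in>right_half_plane \<epsilon>. \<forall>m\<ge>M. \<forall>n>m.
      dist (\<Sum>k\<le>m. dirichlet_term lam a s k) (\<Sum>k\<le>n. dirichlet_term lam a s k) < e"
    proof (intro exI ballI allI impI)
      fix s m n assume s: "s \<in> right_half_plane \<epsilon>" and mn: "M \<le> m" "m < n"
      have "(\<Sum>k\<le>n. dirichlet_term lam a s k) - (\<Sum>k\<le>m. dirichlet_term lam a s k)
          = (\<Sum>k=Suc m..n. dirichlet_term lam a s k)"
        using sum_atMost_eq_lessThan_plus[of "Suc m" n "dirichlet_term lam a s"] mn by (simp add: lessThan_Suc_atMost)
      then have "dist (\<Sum>k\<le>n. dirichlet_term lam a s k) (\<Sum>k\<le>m. dirichlet_term lam a s k) < e"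
        using tail[OF s, of "Suc m" n] M[of "Suc m"] mn by (simp add: dist_norm)
      then show "dist (\<Sum>k\<le>m. dirichlet_term lam a s k) (\<Sum>k\<le>n. dirichlet_term lam a s k) < e"
        by (simp only: dist_commute)
    qed
  qed
qed

theorem theorem4p2:
  fixes lam :: "nat \<Rightarrow> real"
  assumes "frequency lam" and "landau_condition lam"
  shows "(\<forall>\<delta>>0. \<exists>C::real. \<forall>a\<in>D_infty_ext lam. \<forall>N.
            (SUP s\<in>right_half_plane 0. cmod (\<Sum>n\<le>N. dirichlet_term lam a s n))
              \<le> C * exp (\<delta> * lam N) * D_infty_norm lam a)
         \<and> satisfies_bohr lam"
proof (intro conjI allI impI)
  fix \<delta> :: real assume "0 < \<delta>"
  show "\<exists>C::real. \<forall>a\<in>D_infty_ext lam. \<forall>N.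
            (SUP s\<in>right_half_plane 0. cmod (\<Sum>n\<le>N. dirichlet_term lam a s n))
              \<le> C * exp (\<delta> * lam N) * D_infty_norm lam a"
  proof (rule landau_partial_sum_bound[OF assms \<open>0 < \<delta>\<close>], intro exI ballI allI)
    fix C a N
    assume C: "\<And>a N s. a \<in> D_infty_ext lam \<Longrightarrow> 0 < Re s \<Longrightarrow>
        norm (\<Sum>n\<le>N. dirichlet_term lam a s n) \<le> C * exp (\<delta> * lam N) * D_infty_norm lam a"
      and a: "a \<in> D_infty_ext lam"
    show "(SUP s\<in>right_half_plane 0. cmod (\<Sum>n\<le>N. dirichlet_term lam a s n))
        \<le> C * exp (\<delta> * lam N) * D_infty_norm lam a"
    proof (rule cSUP_least[OF right_half_plane_nonempty])
      fix s assume "s \<in> right_half_plane 0"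
      then show "cmod (\<Sum>n\<le>N. dirichlet_term lam a s n) \<le> C * exp (\<delta> * lam N) * D_infty_norm lam a"
        by (intro C a) (simp add: right_half_plane_def)
    qed
  qed
qed (rule landau_imp_bohr[OF assms])

end
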